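(* (a) For $\ell\in\{4,5\}$ and every positive integer $n$, $$\mathrm{ex}(n,\overrightarrow{C}_3,\overrightarrow{C}_\ell)=\left\lceil\frac{n}{3}\right\rceil\left\lceil\frac{n-1}{3}\right\rceil\left\lceil\frac{n-2}{3}\right\rceil.$$ (b) For every integer $\ell>6$ not divisible by $3$, $\mathrm{ex}(n,\overrightarrow{C}_3,\overrightarrow{C}_\ell)=\frac{n^3}{27}+O(n^2)$.
   Context: An oriented graph is a directed graph without loops in which every pair of vertices is joined by at most one arc. $\overrightarrow{C}_m$ denotes the directed cycle of length $m$. A copy of $H$ in $G$ is a (not necessarily induced) subgraph of $G$ isomorphic to $H$. $\mathrm{ex}(n,\overrightarrow{C}_k,\overrightarrow{C}_\ell)$ is the maximum number of copies of $\overrightarrow{C}_k$ in an $n$-vertex oriented graph containing no copy of $\overrightarrow{C}_\ell$. Asymptotics are as $n\to\infty$ with $\ell$ fixed. *)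

theory Defs
  imports Complex_Main "HOL-Library.Landau_Symbols" "Graph_Theory.Graph_Theory"
begin

locale oriented_graph = pair_digraph +
  assumes no_opposite_arcs: "(u, v) \<in> parcs G \<Longrightarrow> (v, u) \<notin> parcs G"

definition dicycle :: "nat \<Rightarrow> nat pair_pre_digraph" where
  "dicycle m = \<lparr>pverts = {..<m}, parcs = {(i, Suc i mod m) | i. i < m}\<rparr>"

definition copies :: "'a pair_pre_digraph \<Rightarrow> 'b pair_pre_digraph \<Rightarrow> 'b pair_pre_digraph set" where
  "copies H G = {K. subgraph (with_proj K) (with_proj G) \<and> digraph_iso (with_proj K) (with_proj H)}"

text \<open>Every finite oriented graph is isomorphic to one whose vertices are natural numbers, so it
  suffices to let \<open>G\<close> range over the latter. The set below is finite by \<open>finite_copy_numbers\<close>.\<close>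

definition gen_turan :: "nat \<Rightarrow> 'a pair_pre_digraph \<Rightarrow> 'b pair_pre_digraph \<Rightarrow> nat" where
  "gen_turan n H F =
     Max {card (copies H G) | G :: nat pair_pre_digraph.
            oriented_graph G \<and> card (pverts G) = n \<and> copies F G = {}}"

lemma card_copies_le:
  fixes G :: "'b pair_pre_digraph"
  assumes "oriented_graph G"
  shows "card (copies H G) \<le> 2 ^ card (pverts G) * 2 ^ (card (pverts G) * card (pverts G))"
proof -
  interpret oriented_graph G by fact
  have fin: "finite (pverts G)" by (rule pair_finite_verts)
  let ?f = "\<lambda>K :: 'b pair_pre_digraph. (pverts K, parcs K)"
  let ?T = "Pow (pverts G) \<times> Pow (pverts G \<times> pverts G)"
  have "inj_on ?f (copies H G)"
    by (auto intro!: inj_onI pair_pre_digraph.equality)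
  moreover have "?f ` copies H G \<subseteq> ?T"
    using wellformed' by (auto simp: copies_def subgraph_def)
  ultimately have "card (copies H G) \<le> card ?T"
    using fin by (intro card_inj_on_le) auto
  then show ?thesis
    using fin by (simp add: card_cartesian_product card_Pow)
qed

lemma finite_copy_numbers:
  "finite {card (copies H G) | G :: nat pair_pre_digraph.
     oriented_graph G \<and> card (pverts G) = n \<and> copies F G = {}}"
  by (rule finite_subset[of _ "{..2 ^ n * 2 ^ (n * n)}"]) (auto dest: card_copies_le)

end

theory Submission
  imports Defs
begin

text \<open>
  If two directed triangles of a \<open>C\<^sub>4\<close>- or \<open>C\<^sub>5\<close>-free oriented graph share an arc, no third
  one contains both of their remaining vertices: the triangles form a cancellative triple system.
  Remove the vertices of a triangle \<open>S\<close> from the \<open>n\<close> vertices. A vertex outside \<open>S\<close> lies in at most one triangle with two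
  vertices in \<open>S\<close>. The pairs outside \<open>S\<close> completing a vertex of \<open>S\<close> to a triangle form a
  \<open>K\<^sub>4\<close>-free graph, since a \<open>K\<^sub>4\<close> would be properly 3-coloured by \<open>S\<close> and give two triangles that
  share one vertex and have all their cross pairs adjacent, which forces both a \<open>C\<^sub>4\<close> and
  a \<open>C\<^sub>5\<close>. Turan's bound \<open>(n - 3)\<^sup>2 / 3\<close> on those pairs is exactly what induction from \<open>n - 3\<close> needs.

  For \<open>l > 6\<close>, delete arcs lying in at most \<open>l\<close> triangles until none is left, losing
  \<open>O(n\<^sup>2)\<close> triangles. Then an arc \<open>x y\<close> can be replaced by a path \<open>x y' z x' y\<close> through new vertices,
  so a cycle of length \<open>k \<le> l - 3\<close> yields one of length \<open>k + 3\<close>, and the graph is free of \<open>C\<^sub>4\<close> or \<open>C\<^sub>5\<close>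
  according to \<open>l\<close> modulo 3.
\<close>

section \<open>Cycles as vertex lists and triangles as vertex sets\<close>

definition is_dicycle :: "'a rel \<Rightarrow> 'a list \<Rightarrow> bool" where
  "is_dicycle E xs \<longleftrightarrow> xs \<noteq> [] \<and> distinct xs \<and> successively (\<lambda>u v. (u, v) \<in> E) xs
     \<and> (last xs, hd xs) \<in> E"

abbreviation tri :: "'a rel \<Rightarrow> 'a \<Rightarrow> 'a \<Rightarrow> 'a \<Rightarrow> bool" where
  "tri E x y z \<equiv> (x, y) \<in> E \<and> (y, z) \<in> E \<and> (z, x) \<in> E"

text \<open>Vertex sets suffice for counting: in an asymmetric relation three vertices span at most
  one directed triangle.\<close>

definition triangles :: "'a rel \<Rightarrow> 'a set set" where
  "triangles E = {{x, y, z} | x y z. tri E x y z}"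

lemma is_dicycle_mono: "is_dicycle E xs \<Longrightarrow> E \<subseteq> F \<Longrightarrow> is_dicycle F xs"
  unfolding is_dicycle_def by (auto intro: successively_mono)

lemma triangles_subset_Pow: "E \<subseteq> V \<times> V \<Longrightarrow> triangles E \<subseteq> Pow V"
  unfolding triangles_def by auto

lemma finite_triangles: "finite V \<Longrightarrow> E \<subseteq> V \<times> V \<Longrightarrow> finite (triangles E)"
  by (rule finite_subset[OF triangles_subset_Pow]) simp_all

section \<open>Edges in graphs without large cliques\<close>

text \<open>Recursion step for Mantel's and Turan's bounds. \<open>A\<close> is symmetric, so each
  edge counts as two ordered pairs. A pair not inside the neighbourhood \<open>N\<close> of a vertex
  of maximum degree has an end outside \<open>N\<close>, and that end has degree at most
  \<open>card N\<close>.\<close>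

lemma max_degree_neighbourhood:
  fixes A :: "'a rel"
  assumes "finite V" "V \<noteq> {}" "sym A"
  obtains v where "v \<in> V"
    "card (A \<inter> V \<times> V) \<le> card (A \<inter> (A `` {v} \<inter> V) \<times> (A `` {v} \<inter> V))
       + 2 * ((card V - card (A `` {v} \<inter> V)) * card (A `` {v} \<inter> V))"
proof -
  define d where "d x = card (A `` {x} \<inter> V)" for x
  have "Max (d ` V) \<in> d ` V"
    using assms by (intro Max_in) auto
  then obtain v where "v \<in> V" "d v = Max (d ` V)" by auto
  then have v: "v \<in> V" "\<And>x. x \<in> V \<Longrightarrow> d x \<le> d v"
    using assms(1) by simp_all
  define N where "N = A `` {v} \<inter> V"
  define B where "B = (SIGMA x:V - N. A `` {x} \<inter> V)"
  have NV: "N \<subseteq> V" by (auto simp: N_def)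
  have fin: "finite B" "finite (A \<inter> N \<times> N)"
    unfolding B_def N_def using assms by auto
  have "card B = (\<Sum>x\<in>V - N. d x)"
    unfolding B_def d_def using assms by (subst card_SigmaI) auto
  also have "\<dots> \<le> card (V - N) * d v"
    using v by (intro sum_bounded_above[of _ _ "d v", simplified]) auto
  also have "card (V - N) = card V - card N"
    using NV assms by (meson card_Diff_subset finite_subset)
  finally have B: "card B \<le> (card V - card N) * card N"
    by (simp add: d_def N_def)
  \<comment> \<open>\<open>B\<close> holds the pairs whose first component is outside
    \<open>N\<close>, its converse those whose second component is.\<close>
  have "A \<inter> V \<times> V \<subseteq> (A \<inter> N \<times> N) \<union> B \<union> B\<inverse>"
    using \<open>sym A\<close> by (auto simp: B_def dest: symD)
  then have "card (A \<inter> V \<times> V) \<le> card ((A \<inter> N \<times> N) \<union> B \<union> B\<inverse>)"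
    using fin by (intro card_mono) auto
  also have "\<dots> \<le> card (A \<inter> N \<times> N) + card B + card (B\<inverse>)"
    by (meson card_Un_le add_le_mono1 order_trans)
  also have "\<dots> \<le> card (A \<inter> N \<times> N) + 2 * ((card V - card N) * card N)"
    using B by simp
  finally show ?thesis using that[OF v(1)] unfolding N_def by blast
qed

text \<open>Mantel's theorem for ordered pairs: the neighbourhood of a vertex of maximum degree
  spans no edge.\<close>

lemma triangle_free_card_le:
  fixes A :: "'a rel"
  assumes "finite V" "sym A"
    and "\<And>x y z. {x, y, z} \<subseteq> V \<Longrightarrow> (x, y) \<in> A \<Longrightarrow> (x, z) \<in> A \<Longrightarrow> (y, z) \<in> A \<Longrightarrow> False"
  shows "2 * card (A \<inter> V \<times> V) \<le> card V ^ 2"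
proof (cases "V = {}")
  case False
  obtain v where v: "v \<in> V"
    "card (A \<inter> V \<times> V) \<le> card (A \<inter> (A `` {v} \<inter> V) \<times> (A `` {v} \<inter> V))
       + 2 * ((card V - card (A `` {v} \<inter> V)) * card (A `` {v} \<inter> V))"
    using max_degree_neighbourhood[OF assms(1) False assms(2)] by blast
  define d where "d = card (A `` {v} \<inter> V)"
  have "A \<inter> (A `` {v} \<inter> V) \<times> (A `` {v} \<inter> V) = {}"
    using assms(3)[of v] v(1) by auto
  with v have le: "card (A \<inter> V \<times> V) \<le> 2 * ((card V - d) * d)"
    by (simp add: d_def)
  have "d \<le> card V"
    unfolding d_def using assms(1) by (simp add: card_mono)
  then obtain m where m: "card V = d + m"
    using le_Suc_ex by blast
  have "4 * (m * d) \<le> (d + m)\<^sup>2"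
    using zero_le_power2[of "int d - int m"]
    by (simp add: power2_eq_square algebra_simps flip: of_nat_mult of_nat_add)
  with le m show ?thesis by simp
qed simp

text \<open>Turan's theorem for \<open>K\<^sub>4\<close>, again for ordered pairs: the neighbourhood
  of a vertex of maximum degree is triangle-free, so Mantel's bound applies inside it.\<close>

lemma K4_free_card_le:
  fixes A :: "'a rel"
  assumes "finite V" "sym A"
    and "\<And>x y z w. {x, y, z, w} \<subseteq> V \<Longrightarrow> (x, y) \<in> A \<Longrightarrow> (x, z) \<in> A \<Longrightarrow> (x, w) \<in> A \<Longrightarrow>
           (y, z) \<in> A \<Longrightarrow> (y, w) \<in> A \<Longrightarrow> (z, w) \<in> A \<Longrightarrow> False"
  shows "3 * card (A \<inter> V \<times> V) \<le> 2 * card V ^ 2"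
proof (cases "V = {}")
  case False
  obtain v where v: "v \<in> V"
    "card (A \<inter> V \<times> V) \<le> card (A \<inter> (A `` {v} \<inter> V) \<times> (A `` {v} \<inter> V))
       + 2 * ((card V - card (A `` {v} \<inter> V)) * card (A `` {v} \<inter> V))"
    using max_degree_neighbourhood[OF assms(1) False assms(2)] by blast
  define d where "d = card (A `` {v} \<inter> V)"
  have "2 * card (A \<inter> (A `` {v} \<inter> V) \<times> (A `` {v} \<inter> V)) \<le> d\<^sup>2"
    unfolding d_def
  proof (rule triangle_free_card_le[OF _ assms(2)])
    fix x y z
    assume "{x, y, z} \<subseteq> A `` {v} \<inter> V" "(x, y) \<in> A" "(x, z) \<in> A" "(y, z) \<in> A"
    then show False using assms(3)[of v x y z] v(1) by auto
  qed (use assms(1) in simp)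
  with v have le: "2 * card (A \<inter> V \<times> V) \<le> d\<^sup>2 + 4 * ((card V - d) * d)"
    by (simp add: d_def)
  have "d \<le> card V"
    unfolding d_def using assms(1) by (simp add: card_mono)
  then obtain m where m: "card V = d + m"
    using le_Suc_ex by blast
  have "3 * (d\<^sup>2 + 4 * (m * d)) \<le> 4 * (d + m)\<^sup>2"
  proof -
    \<comment> \<open>The two sides differ by the square \<open>(d - 2 * m)\<^sup>2\<close>, which
      vanishes when \<open>d\<close> is two thirds of \<open>card V\<close>.\<close>
    have "int (3 * (d\<^sup>2 + 4 * (m * d))) \<le> int (4 * (d + m)\<^sup>2)"
      using zero_le_power2[of "int d - 2 * int m"]
      by (simp add: power2_eq_square algebra_simps)
    then show ?thesis by (simp only: of_nat_le_iff)
  qed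
  with le m show ?thesis by simp
qed simp

section \<open>Triangles in oriented graphs without a directed 4-cycle or 5-cycle\<close>

text \<open>Cancellativity: the arc from \<open>c\<close> to \<open>d\<close> closes the 4-cycle
  \<open>b c d a\<close>, and the path \<open>d e c\<close> closes the 5-cycle
  \<open>d e c a b\<close>.\<close>

lemma no_triangle_through_apexes:
  assumes asym: "asym E" and l: "l \<in> {4, 5}"
    and free: "\<And>xs. length xs = l \<Longrightarrow> \<not> is_dicycle E xs"
    and "tri E a b c" "tri E a b d" "tri E c d e"
  shows False
proof -
  have anti: "\<And>u v. (u, v) \<in> E \<Longrightarrow> (v, u) \<notin> E" using asym by (auto dest: asymD)
  have ne: "distinct [b, c, d, a]" "distinct [d, e, c, a, b]"
    using assms(4-6) anti by auto
  from l consider "l = 4" | "l = 5" by auto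
  then show False
  proof cases
    case 1
    then show False using free[of "[b, c, d, a]"] ne assms(4-6) by (auto simp: is_dicycle_def)
  next
    case 2
    then show False using free[of "[d, e, c, a, b]"] ne assms(4-6) by (auto simp: is_dicycle_def)
  qed
qed

lemma no_complete_bowtie:
  assumes asym: "asym E" and l: "l \<in> {4, 5}"
    and free: "\<And>xs. length xs = l \<Longrightarrow> \<not> is_dicycle E xs"
    and tri: "tri E a b c" "tri E a x y"
    and adj: "(b, x) \<in> E \<union> E\<inverse>" "(b, y) \<in> E \<union> E\<inverse>" "(c, x) \<in> E \<union> E\<inverse>" "(c, y) \<in> E \<union> E\<inverse>"
  shows False
proof -
  have anti: "\<And>u v. (u, v) \<in> E \<Longrightarrow> (v, u) \<notin> E" using asym by (auto dest: asymD)
  have ne: "distinct [a, b, c, x, y]"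
    using tri adj anti by auto
  from l consider "l = 4" | "l = 5" by auto
  then show False
  proof cases
    case 1
    then show False
      \<comment> \<open>One list for each orientation of the pair \<open>b\<close>,
        \<open>x\<close>.\<close>
      using free[of "[a, x, b, c]"] free[of "[a, b, x, y]"] ne tri adj by (auto simp: is_dicycle_def)
  next
    case 2
    then show False
      \<comment> \<open>An arc from \<open>c\<close> to \<open>x\<close> or from \<open>y\<close> to
        \<open>b\<close> gives one of the first two cycles. Otherwise the arcs go from
        \<open>x\<close> to \<open>c\<close> and from \<open>b\<close> to \<open>y\<close>, and each
        of the four orientations of the pairs \<open>b\<close>, \<open>x\<close> and
        \<open>c\<close>, \<open>y\<close> gives one of the other cycles.\<close>
      using free[of "[a, b, c, x, y]"] free[of "[a, x, y, b, c]"] free[of "[a, x, b, y, c]"]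
        free[of "[a, x, b, c, y]"] free[of "[a, b, x, c, y]"] free[of "[a, b, x, y, c]"] ne tri adj
      by (auto simp: is_dicycle_def)
  qed
qed

text \<open>Triangles are sorted by their number of vertices in \<open>S = {a, b, c}\<close>: none
  gives the recursive term, one gives \<open>p\<close>, two give at most \<open>card W\<close>, and
  three give only \<open>S\<close> itself.\<close>

lemma triangle_removal:
  fixes E :: "'a rel"
  assumes fin: "finite V" and EV: "E \<subseteq> V \<times> V" and asym: "asym E" and l: "l \<in> {4, 5}"
    and free: "\<And>xs. length xs = l \<Longrightarrow> \<not> is_dicycle E xs"
    and abc: "tri E a b c" and W: "W = V - {a, b, c}"
  obtains p where "card (triangles E) \<le> card (triangles (E \<inter> W \<times> W)) + p + card W + 1"
    "3 * p \<le> card W ^ 2"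
proof -
  have anti: "\<And>u v. (u, v) \<in> E \<Longrightarrow> (v, u) \<notin> E" using asym by (auto dest: asymD)
  note apex = no_triangle_through_apexes[OF asym l free]
  define S where "S = {a, b, c}"
  have S3: "card S = 3" "finite S"
    using abc anti by (auto simp: S_def card_insert_if)
  have S_adj: "s = t \<or> (\<exists>u. tri E s t u \<or> tri E t s u)" if "s \<in> S" "t \<in> S" for s t
    using that abc by (auto simp: S_def)
  have finW: "finite W" using fin W by simp
  define Q1 where "Q1 = {(s, x, y). s \<in> S \<and> x \<in> W \<and> y \<in> W \<and> tri E s x y}"
  define Q2 where "Q2 = {(s, t, x). s \<in> S \<and> t \<in> S \<and> x \<in> W \<and> tri E s t x}"
  define P where "P = {(x, y). x \<in> W \<and> y \<in> W \<and> (\<exists>s\<in>S. tri E s x y)}"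
  have "Q1 \<subseteq> S \<times> W \<times> W" "Q2 \<subseteq> S \<times> S \<times> W" "P \<subseteq> W \<times> W"
    by (auto simp: Q1_def Q2_def P_def)
  then have finQ: "finite Q1" "finite Q2" "finite P"
    using finW S3(2) by (meson finite_SigmaI finite_subset)+
  have "inj_on snd Q1"
  proof (rule inj_onI)
    fix p q
    assume "p \<in> Q1" "q \<in> Q1" "snd p = snd q"
    then obtain s t x y where *: "p = (s, x, y)" "q = (t, x, y)" "s \<in> S" "t \<in> S"
      "tri E s x y" "tri E t x y"
      by (auto simp: Q1_def)
    then show "p = q"
      \<comment> \<open>Distinct \<open>s\<close> and \<open>t\<close> would be apexes over the
        common arc from \<open>x\<close> to \<open>y\<close>, and they are joined by an arc of the
        triangle \<open>S\<close>.\<close>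
      using S_adj[OF *(3,4)] apex[of x y s t] apex[of x y t s] by blast
  qed
  moreover have "snd ` Q1 \<subseteq> P"
    by (auto simp: Q1_def P_def)
  ultimately have Q1: "card Q1 \<le> card P"
    using finQ by (meson card_inj_on_le)
  \<comment> \<open>Two arcs of \<open>S\<close> meet head to tail, so triangles on both with the
    same \<open>x\<close> would need opposite arcs between \<open>x\<close> and the common
    vertex.\<close>
  have "inj_on (\<lambda>(s, t, x). x) Q2"
    by (rule inj_onI) (use abc anti in \<open>auto simp: Q2_def S_def\<close>)
  moreover have "(\<lambda>(s, t, x). x) ` Q2 \<subseteq> W"
    by (auto simp: Q2_def)
  ultimately have Q2: "card Q2 \<le> card W"
    using finW by (meson card_inj_on_le)
  let ?f = "\<lambda>(x, y, z). {x, y, z}"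
  have cover: "triangles E \<subseteq> triangles (E \<inter> W \<times> W) \<union> ?f ` Q1 \<union> ?f ` Q2 \<union> {S}"
  proof
    fix e assume "e \<in> triangles E"
    then obtain x y z where e: "e = {x, y, z}" and t: "tri E x y z"
      by (auto simp: triangles_def)
    have V: "x \<in> S \<or> x \<in> W" "y \<in> S \<or> y \<in> W" "z \<in> S \<or> z \<in> W"
      using t EV by (auto simp: S_def W)
    have q1: "e \<in> ?f ` Q1" if "(s, u, v) \<in> Q1" "e = {s, u, v}" for s u v
      using that by force
    have q2: "e \<in> ?f ` Q2" if "(s, u, v) \<in> Q2" "e = {s, u, v}" for s u v
      using that by force
    have rot: "e = {y, z, x}" "e = {z, x, y}" using e by auto
    \<comment> \<open>A triangle with one vertex in \<open>S\<close> is rotated to start there, one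
      with two vertices in \<open>S\<close> to end in \<open>W\<close>.\<close>
    have "x \<in> W \<and> y \<in> W \<and> z \<in> W \<or> (x, y, z) \<in> Q1 \<or> (y, z, x) \<in> Q1 \<or> (z, x, y) \<in> Q1
      \<or> (x, y, z) \<in> Q2 \<or> (y, z, x) \<in> Q2 \<or> (z, x, y) \<in> Q2 \<or> x \<in> S \<and> y \<in> S \<and> z \<in> S"
      using V by (elim disjE) (simp_all add: Q1_def Q2_def t)
    then consider "x \<in> W" "y \<in> W" "z \<in> W" | "(x, y, z) \<in> Q1" | "(y, z, x) \<in> Q1" | "(z, x, y) \<in> Q1"
      | "(x, y, z) \<in> Q2" | "(y, z, x) \<in> Q2" | "(z, x, y) \<in> Q2" | "x \<in> S" "y \<in> S" "z \<in> S"
      by blast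
    then show "e \<in> triangles (E \<inter> W \<times> W) \<union> ?f ` Q1 \<union> ?f ` Q2 \<union> {S}"
    proof cases
      case 1
      then show ?thesis using e t by (auto simp: triangles_def)
    next
      case 8
      have "card e = 3" using t anti e by (auto simp: card_insert_if)
      then have "e = S" using 8 S3 e by (intro card_subset_eq) auto
      then show ?thesis by simp
    qed (use q1 q2 e rot in blast)+
  qed
  have "card (triangles E) \<le> card (triangles (E \<inter> W \<times> W) \<union> ?f ` Q1 \<union> ?f ` Q2 \<union> {S})"
    using finQ finite_triangles[OF finW, of "E \<inter> W \<times> W"] by (intro card_mono cover) auto
  also have "\<dots> \<le> card (triangles (E \<inter> W \<times> W)) + card (?f ` Q1) + card (?f ` Q2) + card {S}"
    by (meson card_Un_le add_le_mono1 order_trans)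
  also have "\<dots> \<le> card (triangles (E \<inter> W \<times> W)) + card P + card W + 1"
    using Q1 Q2 card_image_le[OF finQ(1), of ?f] card_image_le[OF finQ(2), of ?f] by simp
  finally have bound:
    "card (triangles E) \<le> card (triangles (E \<inter> W \<times> W)) + card P + card W + 1" .

  define A where "A = P \<union> P\<inverse>"
  have colour: "\<exists>s\<in>S. tri E s x y \<or> tri E s y x" if "(x, y) \<in> A" for x y
    using that by (auto simp: A_def P_def)
  \<comment> \<open>Vertices of \<open>S\<close> act as colours of the edges of \<open>A\<close>. If
    \<open>x y\<close> and \<open>x z\<close> had the same colour, asymmetry would put both
    triangles on the same arc between that colour and \<open>x\<close>; their apexes
    \<open>y\<close> and \<open>z\<close> would lie in a third triangle.\<close>
  have distinct_colours: "s \<noteq> t"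
    if xy: "tri E s x y \<or> tri E s y x" and xz: "tri E t x z \<or> tri E t z x" and yz: "(y, z) \<in> A"
    for s t x y z
  proof
    assume [simp]: "s = t"
    obtain u where "tri E y z u \<or> tri E z y u"
      using colour[OF yz] by blast
    then show False
      using xy xz anti apex[of t x y z u] apex[of t x z y u]
        apex[of x t y z u] apex[of x t z y u]
      by auto
  qed
  \<comment> \<open>The three edges at a vertex of a \<open>K\<^sub>4\<close> have different
    colours, hence use all of \<open>S\<close>, and each colour is adjacent to that vertex.\<close>
  have all_adj: "(s, x) \<in> E \<union> E\<inverse>"
    if A: "(x, y) \<in> A" "(x, z) \<in> A" "(x, w) \<in> A" "(y, z) \<in> A" "(y, w) \<in> A" "(z, w) \<in> A"
      and "s \<in> S"
    for x y z w s
  proof -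
    obtain i j k where ijk: "i \<in> S" "j \<in> S" "k \<in> S"
      "tri E i x y \<or> tri E i y x" "tri E j x z \<or> tri E j z x" "tri E k x w \<or> tri E k w x"
      using colour[OF A(1)] colour[OF A(2)] colour[OF A(3)] by blast
    then have "i \<noteq> j" "i \<noteq> k" "j \<noteq> k"
      using distinct_colours A(4-6) by blast+
    then have "{i, j, k} = S"
      using ijk S3 by (intro card_subset_eq) auto
    then show ?thesis
      using ijk(4-6) \<open>s \<in> S\<close> by auto
  qed
  have symA: "sym A" by (auto simp: A_def sym_def)
  have "3 * card (A \<inter> W \<times> W) \<le> 2 * card W ^ 2"
  proof (rule K4_free_card_le[OF finW symA])
    fix x y z w
    assume A: "(x, y) \<in> A" "(x, z) \<in> A" "(x, w) \<in> A" "(y, z) \<in> A" "(y, w) \<in> A" "(z, w) \<in> A"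
    have x: "\<And>s. s \<in> S \<Longrightarrow> (s, x) \<in> E \<union> E\<inverse>"
      using all_adj[of x y z w] A by blast
    have y: "\<And>s. s \<in> S \<Longrightarrow> (s, y) \<in> E \<union> E\<inverse>"
      using all_adj[of y x z w] A symA by (meson symD)
    obtain s where s: "s \<in> S" "tri E s x y \<or> tri E s y x"
      using colour[OF A(1)] by blast
    \<comment> \<open>\<open>S\<close> and the triangle on the edge \<open>x y\<close> share the
      colour \<open>s\<close>; as \<open>x\<close> and \<open>y\<close> are adjacent to all of
      \<open>S\<close>, they form a complete bowtie.\<close>
    obtain t u where "tri E s t u" "t \<in> S" "u \<in> S"
      using s(1) abc by (auto simp: S_def)
    then show False
      using s(2) x y no_complete_bowtie[OF asym l free, of s t u x y]
        no_complete_bowtie[OF asym l free, of s t u y x] by blast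
  qed
  moreover have "A \<inter> W \<times> W = P \<union> P\<inverse>"
    by (auto simp: A_def P_def)
  moreover have "card (P \<union> P\<inverse>) = 2 * card P"
    using finQ anti by (subst card_Un_disjoint) (auto simp: P_def)
  ultimately have "3 * card P \<le> card W ^ 2" by simp
  with bound show ?thesis by (rule that)
qed

text \<open>The product of the part sizes in a balanced tripartition of \<open>n\<close> vertices;
  the factors are the ceilings of \<open>(n - 2) / 3\<close>, \<open>(n - 1) / 3\<close> and
  \<open>n / 3\<close>.\<close>

definition tripartite :: "nat \<Rightarrow> nat" where
  "tripartite n = (n div 3) * ((n + 1) div 3) * ((n + 2) div 3)"

lemma tripartite_cases:
  obtains k where "n = 3 * k" "tripartite n = k ^ 3" "tripartite (n + 3) = (k + 1) ^ 3"
  | k where "n = 3 * k + 1" "tripartite n = k ^ 2 * (k + 1)"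
      "tripartite (n + 3) = (k + 1) ^ 2 * (k + 2)"
  | k where "n = 3 * k + 2" "tripartite n = k * (k + 1) ^ 2"
      "tripartite (n + 3) = (k + 1) * (k + 2) ^ 2"
proof -
  have "n mod 3 < 3" by simp
  then consider "n = 3 * (n div 3)" | "n = 3 * (n div 3) + 1" | "n = 3 * (n div 3) + 2"
    by linarith
  then show thesis
  proof cases
    case 1
    define k where "k = n div 3"
    have n: "n = 3 * k" using 1 k_def by simp
    have "n div 3 = k" "(n + 1) div 3 = k" "(n + 2) div 3 = k"
      "(n + 3) div 3 = k + 1" "(n + 3 + 1) div 3 = k + 1" "(n + 3 + 2) div 3 = k + 1"
      using n by linarith+
    then show ?thesis
      by (intro that(1)[OF n]) (simp_all only: tripartite_def power3_eq_cube)
  next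
    case 2
    define k where "k = n div 3"
    have n: "n = 3 * k + 1" using 2 k_def by simp
    have "n div 3 = k" "(n + 1) div 3 = k" "(n + 2) div 3 = k + 1"
      "(n + 3) div 3 = k + 1" "(n + 3 + 1) div 3 = k + 1" "(n + 3 + 2) div 3 = k + 2"
      using n by linarith+
    then show ?thesis
      by (intro that(2)[OF n]) (simp_all only: tripartite_def power2_eq_square)
  next
    case 3
    define k where "k = n div 3"
    have n: "n = 3 * k + 2" using 3 k_def by simp
    have "n div 3 = k" "(n + 1) div 3 = k + 1" "(n + 2) div 3 = k + 1"
      "(n + 3) div 3 = k + 1" "(n + 3 + 1) div 3 = k + 2" "(n + 3 + 2) div 3 = k + 2"
      using n by linarith+
    then show ?thesis
      by (intro that(3)[OF n]) (simp_all only: tripartite_def power2_eq_square mult.assoc)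
  qed
qed

text \<open>Three more vertices enlarge each part by one, so the product grows by the sum of the
  pairwise products of the parts, plus \<open>n + 1\<close>. That sum is the integer part of
  \<open>n ^ 2 / 3\<close>, hence at least \<open>p\<close>.\<close>

lemma tripartite_step:
  assumes "3 * p \<le> n ^ 2"
  shows "tripartite n + p + n + 1 \<le> tripartite (n + 3)"
proof (cases n rule: tripartite_cases)
  case (1 k)
  then have "p \<le> 3 * k\<^sup>2" using assms by (simp add: power2_eq_square)
  then show ?thesis
    unfolding 1(2,3) using 1(1) by (simp add: power3_eq_cube power2_eq_square algebra_simps)
next
  case (2 k)
  then have "p \<le> 3 * k\<^sup>2 + 2 * k" using assms by (simp add: power2_eq_square algebra_simps)
  then show ?thesis
    unfolding 2(2,3) using 2(1) by (simp add: power2_eq_square algebra_simps)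
next
  case (3 k)
  then have "p \<le> 3 * k\<^sup>2 + 4 * k + 1" using assms by (simp add: power2_eq_square algebra_simps)
  then show ?thesis
    unfolding 3(2,3) using 3(1) by (simp add: power2_eq_square algebra_simps)
qed

text \<open>Induction by removing the vertices of a triangle: the loss in
  \<open>triangle_removal\<close> is what \<open>tripartite_step\<close> allows.\<close>

lemma card_triangles_le_tripartite:
  fixes E :: "'a rel"
  assumes "finite V" "E \<subseteq> V \<times> V" "asym E" "l \<in> {4, 5}"
    and "\<And>xs. length xs = l \<Longrightarrow> \<not> is_dicycle E xs"
  shows "card (triangles E) \<le> tripartite (card V)"
  using assms
proof (induction "card V" arbitrary: V E rule: less_induct)
  case less
  show ?case
  proof (cases "triangles E = {}")
    case False
    then obtain a b c where abc: "tri E a b c"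
      by (auto simp: triangles_def)
    define W where "W = V - {a, b, c}"
    obtain p where p: "card (triangles E) \<le> card (triangles (E \<inter> W \<times> W)) + p + card W + 1"
      "3 * p \<le> card W ^ 2"
      using triangle_removal[OF less.prems abc W_def] by metis
    have sub: "{a, b, c} \<subseteq> V" using abc less.prems(2) by auto
    have "card {a, b, c} = 3"
      using abc less.prems(3) by (auto simp: card_insert_if dest: asymD)
    then have V: "card V = card W + 3"
      using sub less.prems(1) card_mono[OF less.prems(1) sub]
      by (simp add: W_def card_Diff_subset)
    have "card (triangles (E \<inter> W \<times> W)) \<le> tripartite (card W)"
    proof (rule less.hyps)
      show "asym (E \<inter> W \<times> W)"
        using less.prems(3) by (auto intro!: asymI dest: asymD)
      show "\<not> is_dicycle (E \<inter> W \<times> W) xs" if "length xs = l" for xs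
        using less.prems(5)[OF that] is_dicycle_mono by blast
    qed (use V less.prems in \<open>auto simp: W_def\<close>)
    with p tripartite_step[OF p(2)] show ?thesis unfolding V by linarith
  qed simp
qed

section \<open>Lengthening cycles through arcs in many triangles\<close>

text \<open>The inequality is strict so that every arc still has an apex after \<open>k\<close>
  vertices are forbidden.\<close>

definition robust :: "nat \<Rightarrow> 'a rel \<Rightarrow> bool" where
  "robust k E \<longleftrightarrow> (\<forall>(x, y) \<in> E. k < card {z. (y, z) \<in> E \<and> (z, x) \<in> E})"

lemma robust_obtain_apex:
  assumes "robust k E" "(x, y) \<in> E" "finite F" "card F \<le> k"
  obtains z where "z \<notin> F" "(y, z) \<in> E" "(z, x) \<in> E"
proof -
  have "\<not> {z. (y, z) \<in> E \<and> (z, x) \<in> E} \<subseteq> F"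
  proof
    assume "{z. (y, z) \<in> E \<and> (z, x) \<in> E} \<subseteq> F"
    then have "card {z. (y, z) \<in> E \<and> (z, x) \<in> E} \<le> card F"
      using assms(3) by (rule card_mono[rotated])
    with assms show False by (auto simp: robust_def)
  qed
  with that show thesis by auto
qed

lemma robust_lengthen_dicycle:
  assumes rob: "robust k E" and cyc: "is_dicycle E xs" and len: "length xs + 2 \<le> k"
  obtains ys where "is_dicycle E ys" "length ys = length xs + 3"
proof -
  have xs: "xs \<noteq> []" "distinct xs" "successively (\<lambda>u v. (u, v) \<in> E) xs" "(last xs, hd xs) \<in> E"
    using cyc by (auto simp: is_dicycle_def)
  have card: "card (set xs) = length xs" using xs(2) by (rule distinct_card)
  \<comment> \<open>The closing arc gets an apex \<open>z\<close>, but the arcs run from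
    \<open>hd xs\<close> to \<open>z\<close> and from \<open>z\<close> to \<open>last xs\<close>.
    Apexes \<open>y\<close> and \<open>x\<close> over these two give paths back, so
    \<open>last xs, y, z, x, hd xs\<close> replaces the closing arc. At most
    \<open>length xs + 2\<close> vertices are avoided.\<close>
  obtain z where z: "z \<notin> set xs" "(hd xs, z) \<in> E" "(z, last xs) \<in> E"
    by (rule robust_obtain_apex[OF rob xs(4), of "set xs"]) (use card len in auto)
  obtain y where y: "y \<notin> insert z (set xs)" "(last xs, y) \<in> E" "(y, z) \<in> E"
    by (rule robust_obtain_apex[OF rob z(3), of "insert z (set xs)"])
      (use card len z in \<open>auto simp: card_insert_if\<close>)
  obtain x where x: "x \<notin> insert y (insert z (set xs))" "(z, x) \<in> E" "(x, hd xs) \<in> E"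
    by (rule robust_obtain_apex[OF rob z(2), of "insert y (insert z (set xs))"])
      (use card len y z in \<open>auto simp: card_insert_if\<close>)
  have "is_dicycle E (xs @ [y, z, x])"
    using xs x y z by (auto simp: is_dicycle_def successively_append_iff)
  then show thesis using that by force
qed

text \<open>The bound is \<open>k + 1\<close> because the last extension starts from a cycle three
  shorter, whose length plus 2 must not exceed \<open>k\<close>.\<close>

lemma robust_lengthen_dicycle_mult:
  assumes "robust k E" "is_dicycle E xs" "length xs + 3 * m \<le> k + 1"
  shows "\<exists>ys. is_dicycle E ys \<and> length ys = length xs + 3 * m"
  using assms(3)
proof (induction m)
  case (Suc m)
  then obtain ys where ys: "is_dicycle E ys" "length ys = length xs + 3 * m" by auto
  obtain zs where "is_dicycle E zs" "length zs = length ys + 3"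
    by (rule robust_lengthen_dicycle[OF assms(1) ys(1)]) (use ys(2) Suc.prems in auto)
  with ys(2) show ?case by (intro exI[of _ zs]) simp
qed (use assms in auto)

text \<open>Arcs in at most \<open>k\<close> triangles are deleted one at a time; each deletion
  destroys at most \<open>k\<close> triangles.\<close>

lemma robust_subgraph:
  fixes E :: "'a rel"
  assumes "finite E"
  obtains F where "F \<subseteq> E" "robust k F" "card (triangles E) \<le> card (triangles F) + k * card (E - F)"
proof -
  have "\<exists>F\<subseteq>E. robust k F \<and> card (triangles E) \<le> card (triangles F) + k * card (E - F)"
    using assms
  proof (induction "card E" arbitrary: E rule: less_induct)
    case less
    show ?case
    proof (cases "robust k E")
      case False
      then obtain x y where xy: "(x, y) \<in> E" "card {z. (y, z) \<in> E \<and> (z, x) \<in> E} \<le> k"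
        by (auto simp: robust_def not_less)
      let ?Z = "{z. (y, z) \<in> E \<and> (z, x) \<in> E}" and ?E = "E - {(x, y)}"
      have "card ?E < card E"
        using xy less.prems by (meson card_Diff1_less)
      then obtain F where F: "F \<subseteq> ?E" "robust k F"
        "card (triangles ?E) \<le> card (triangles F) + k * card (?E - F)"
        using less.hyps[of ?E] less.prems by blast
      \<comment> \<open>An infinite set has \<open>card\<close> 0, so finiteness must come from
        \<open>E\<close>, not from the bound \<open>k\<close>.\<close>
      have finZ: "finite ?Z"
        by (rule finite_subset[of _ "snd ` E"]) (use less.prems in \<open>auto intro: rev_image_eqI\<close>)
      have "triangles E \<subseteq> triangles ?E \<union> (\<lambda>z. {x, y, z}) ` ?Z"
      proof
        fix e assume "e \<in> triangles E"
        then obtain u v w where e: "e = {u, v, w}" "tri E u v w"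
          by (auto simp: triangles_def)
        show "e \<in> triangles ?E \<union> (\<lambda>z. {x, y, z}) ` ?Z"
        proof (cases "tri ?E u v w")
          case True
          then show ?thesis using e unfolding triangles_def by blast
        next
          case False
          then have "(u, v) = (x, y) \<or> (v, w) = (x, y) \<or> (w, u) = (x, y)"
            using e by auto
          then show ?thesis using e by auto
        qed
      qed
      moreover have "finite (triangles ?E)"
        by (rule finite_triangles[of "Field E"])
          (use less.prems finite_Field in \<open>auto intro: FieldI1 FieldI2\<close>)
      ultimately have "card (triangles E) \<le> card (triangles ?E \<union> (\<lambda>z. {x, y, z}) ` ?Z)"
        using finZ by (intro card_mono) auto
      also have "\<dots> \<le> card (triangles ?E) + card ((\<lambda>z. {x, y, z}) ` ?Z)"
        by (rule card_Un_le)
      also have "\<dots> \<le> card (triangles ?E) + k"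
        using card_image_le[OF finZ, of "\<lambda>z. {x, y, z}"] xy(2) by linarith
      also have "\<dots> \<le> card (triangles F) + k * (card (?E - F) + 1)"
        using F(3) by simp
      also have "card (?E - F) + 1 = card (E - F)"
      proof -
        have "E - F = insert (x, y) (?E - F)" using xy F by auto
        then show ?thesis using less.prems by simp
      qed
      finally show ?thesis using F by blast
    qed auto
  qed
  with that show thesis by blast
qed

lemma card_triangles_le_tripartite_plus:
  fixes E :: "'a rel"
  assumes "finite V" "E \<subseteq> V \<times> V" "asym E" "l > 6" "\<not> 3 dvd l"
    and free: "\<And>xs. length xs = l \<Longrightarrow> \<not> is_dicycle E xs"
  shows "card (triangles E) \<le> tripartite (card V) + l * card V ^ 2"
proof -
  have finE: "finite E" using assms(1,2) by (meson finite_SigmaI finite_subset)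
  obtain F where F: "F \<subseteq> E" "robust l F"
    "card (triangles E) \<le> card (triangles F) + l * card (E - F)"
    using robust_subgraph[OF finE] .
  \<comment> \<open>\<open>r\<close> is the one of 4 and 5 congruent to \<open>l\<close> modulo 3,
    so a cycle of length \<open>r\<close> in \<open>F\<close> would lengthen to one of length
    \<open>l\<close>.\<close>
  define r where "r = 3 + l mod 3"
  have "l mod 3 \<noteq> 0" "l mod 3 < 3"
    using assms(5) by (auto simp: dvd_eq_mod_eq_0)
  then have r: "r \<in> {4, 5}" by (auto simp: r_def)
  have l: "l = r + 3 * (l div 3 - 1)"
    using assms(4) unfolding r_def by presburger
  have "\<not> is_dicycle F xs" if "length xs = r" for xs
  proof
    assume "is_dicycle F xs"
    moreover have "length xs + 3 * (l div 3 - 1) = l"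
      using l that by linarith
    ultimately obtain ys where "is_dicycle F ys" "length ys = l"
      using robust_lengthen_dicycle_mult[OF F(2), of xs "l div 3 - 1"] by auto
    with free F(1) is_dicycle_mono show False by blast
  qed
  moreover have "asym F" using F(1) assms(3) by (auto intro!: asymI dest: asymD)
  moreover have "F \<subseteq> V \<times> V" using F(1) assms(2) by blast
  ultimately have "card (triangles F) \<le> tripartite (card V)"
    using card_triangles_le_tripartite[OF assms(1) _ _ r] by blast
  moreover have "card (E - F) \<le> card (V \<times> V)"
    using assms by (intro card_mono) auto
  then have "l * card (E - F) \<le> l * card V ^ 2"
    by (simp add: card_cartesian_product power2_eq_square)
  ultimately show ?thesis using F(3) by linarith
qed

section \<open>Copies of directed cycles\<close>

text \<open>Replaces isomorphisms by injective labellings \<open>f\<close> of the cycle's vertices.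
  From a copy, \<open>f\<close> is the inverse of the vertex map; conversely, the inverse of
  \<open>f\<close> induces the isomorphism.\<close>

lemma copies_dicycle_iff:
  fixes G :: "'a pair_pre_digraph"
  assumes "pair_wf_digraph G"
  shows "K \<in> copies (dicycle l) G \<longleftrightarrow>
    (\<exists>f. inj_on f {..<l} \<and> f ` {..<l} \<subseteq> pverts G \<and> (\<forall>i<l. (f i, f (Suc i mod l)) \<in> parcs G) \<and>
       K = \<lparr>pverts = f ` {..<l}, parcs = (\<lambda>i. (f i, f (Suc i mod l))) ` {..<l}\<rparr>)"
    (is "_ \<longleftrightarrow> (\<exists>f. ?P f)")
proof
  assume "K \<in> copies (dicycle l) G"
  then obtain h where sub: "subgraph (with_proj K) (with_proj G)"
    and iso: "pre_digraph.digraph_isomorphism (with_proj K) h"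
    and eq: "with_proj (dicycle l) = app_iso h (with_proj K)"
    by (auto simp: copies_def digraph_iso_def)
  have inj: "inj_on (iso_verts h) (pverts K)"
    and arcs: "\<And>a. a \<in> parcs K \<Longrightarrow> iso_verts h (fst a) = iso_tail h (iso_arcs h a) \<and>
       iso_verts h (snd a) = iso_head h (iso_arcs h a)"
    and wf: "wf_digraph (with_proj K)"
    using iso by (auto simp: pre_digraph.digraph_isomorphism_def)
  have verts: "iso_verts h ` pverts K = {..<l}"
    using arg_cong[OF eq, of verts] by (simp add: dicycle_def)
  have arcs_im: "iso_arcs h ` parcs K = (\<lambda>i. (i, Suc i mod l)) ` {..<l}"
    using arg_cong[OF eq, of pre_digraph.arcs] by (auto simp: dicycle_def)
  have "iso_tail h = fst" "iso_head h = snd"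
    using arg_cong[OF eq, of tail] arg_cong[OF eq, of head] by simp_all
  with arcs have arcs_eq: "iso_arcs h a = (iso_verts h (fst a), iso_verts h (snd a))"
    if "a \<in> parcs K" for a
    using that by (metis prod.collapse)
  define f where "f = the_inv_into (pverts K) (iso_verts h)"
  have fh: "f (iso_verts h x) = x" if "x \<in> pverts K" for x
    using that inj by (simp add: f_def the_inv_into_f_f)
  have inv: "f ` {..<l} = pverts K"
    unfolding verts[symmetric] using fh by force
  have Karcs: "fst a \<in> pverts K" "snd a \<in> pverts K" if "a \<in> parcs K" for a
    using wf_digraph.tail_in_verts[OF wf, of a] wf_digraph.head_in_verts[OF wf, of a] that by simp_all
  have "(\<lambda>i. (f i, f (Suc i mod l))) ` {..<l} = map_prod f f ` (\<lambda>i. (i, Suc i mod l)) ` {..<l}"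
    by (simp add: image_image)
  also have "\<dots> = map_prod f f ` iso_arcs h ` parcs K"
    by (simp only: arcs_im)
  also have "\<dots> = (\<lambda>a. a) ` parcs K"
    unfolding image_image by (rule image_cong) (auto simp: arcs_eq fh dest: Karcs)
  finally have arcsK: "(\<lambda>i. (f i, f (Suc i mod l))) ` {..<l} = parcs K" by simp
  have "pverts K \<subseteq> pverts G" "parcs K \<subseteq> parcs G"
    using sub by (auto simp: subgraph_def)
  moreover have "inj_on f {..<l}"
    unfolding f_def using inj_on_the_inv_into[OF inj] verts by simp
  moreover have "K = \<lparr>pverts = f ` {..<l}, parcs = (\<lambda>i. (f i, f (Suc i mod l))) ` {..<l}\<rparr>"
    unfolding arcsK inv by simp
  ultimately show "\<exists>f. ?P f"
    using arcsK inv by (intro exI[of _ f]) blast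
next
  assume "\<exists>f. ?P f"
  then obtain f where inj: "inj_on f {..<l}" and verts: "f ` {..<l} \<subseteq> pverts G"
    and arcs: "\<And>i. i < l \<Longrightarrow> (f i, f (Suc i mod l)) \<in> parcs G"
    and K: "K = \<lparr>pverts = f ` {..<l}, parcs = (\<lambda>i. (f i, f (Suc i mod l))) ` {..<l}\<rparr>"
    by blast
  have modl: "Suc i mod l < l" if "i < l" for i
    using that by (intro mod_less_divisor) auto
  have wf: "wf_digraph (with_proj K)"
    by unfold_locales (auto simp: K modl)
  interpret G: pair_wf_digraph G by fact
  have "subgraph (with_proj K) (with_proj G)"
    using verts arcs wf G.wf_digraph_axioms by (auto simp: subgraph_def K compatible_def)
  moreover have "digraph_iso (with_proj K) (with_proj (dicycle l))"
  proof -
    define g where "g = the_inv_into {..<l} f"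
    have gf: "g (f i) = i" if "i < l" for i
      using inj that by (simp add: g_def the_inv_into_f_f)
    define h where "h = \<lparr>iso_verts = g, iso_arcs = map_prod g g, iso_head = snd, iso_tail = fst\<rparr>"
    have "pre_digraph.digraph_isomorphism (with_proj K) h"
      using wf by (auto simp: pre_digraph.digraph_isomorphism_def h_def K inj_on_def gf modl)
    moreover have "with_proj (dicycle l) = app_iso h (with_proj K)"
      by (auto simp: app_iso_def h_def K dicycle_def image_image gf modl image_iff Bex_def
          intro!: pre_digraph.equality)
    ultimately show ?thesis by (auto simp: digraph_iso_def)
  qed
  ultimately show "K \<in> copies (dicycle l) G"
    by (simp add: copies_def)
qed

lemma copies_dicycle_empty_imp_free:
  assumes "pair_wf_digraph G" "copies (dicycle (length xs)) G = {}"
  shows "\<not> is_dicycle (parcs G) xs"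
proof
  interpret pair_wf_digraph G by fact
  let ?l = "length xs"
  assume "is_dicycle (parcs G) xs"
  then have xs: "xs \<noteq> []" "distinct xs" "(last xs, hd xs) \<in> parcs G"
    "\<And>i. Suc i < ?l \<Longrightarrow> (xs ! i, xs ! Suc i) \<in> parcs G"
    by (auto simp: is_dicycle_def successively_conv_nth)
  have arcs: "(xs ! i, xs ! (Suc i mod ?l)) \<in> parcs G" if "i < ?l" for i
  proof (cases "Suc i = ?l")
    case True
    then show ?thesis using xs by (simp add: last_conv_nth hd_conv_nth flip: True)
  next
    case False
    then show ?thesis using xs(4) that by auto
  qed
  have "inj_on ((!) xs) {..<?l}" using xs(2) by (simp add: inj_on_nth)
  moreover have "(!) xs ` {..<?l} \<subseteq> pverts G"
    using arcs in_arcsD1 by blast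
  ultimately have "copies (dicycle ?l) G \<noteq> {}"
    using arcs copies_dicycle_iff[OF assms(1)] by blast
  with assms(2) show False by simp
qed

lemma card_copies_dicycle_3:
  assumes "oriented_graph G"
  shows "card (copies (dicycle 3) G) = card (triangles (parcs G))"
proof -
  interpret oriented_graph G by fact
  have wf: "pair_wf_digraph G" by unfold_locales
  have three: "{..<3::nat} = {0, 1, 2}" by auto
  have copies: "K \<in> copies (dicycle 3) G \<longleftrightarrow> (\<exists>x y z. tri (parcs G) x y z \<and>
     K = \<lparr>pverts = {x, y, z}, parcs = {(x, y), (y, z), (z, x)}\<rparr>)" for K
  proof
    assume "K \<in> copies (dicycle 3) G"
    then obtain f where f: "\<forall>i<3. (f i, f (Suc i mod 3)) \<in> parcs G"
      "K = \<lparr>pverts = f ` {..<3}, parcs = (\<lambda>i. (f i, f (Suc i mod 3))) ` {..<3}\<rparr>"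
      using copies_dicycle_iff[OF wf] by blast
    have "tri (parcs G) (f 0) (f 1) (f 2)"
      using f(1)[rule_format, of 0] f(1)[rule_format, of 1] f(1)[rule_format, of 2]
      by (simp add: numeral_2_eq_2)
    with f(2) show "\<exists>x y z. tri (parcs G) x y z \<and>
     K = \<lparr>pverts = {x, y, z}, parcs = {(x, y), (y, z), (z, x)}\<rparr>"
      by (intro exI[of _ "f 0"] exI[of _ "f 1"] exI[of _ "f 2"])
        (simp add: three numeral_2_eq_2)
  next
    assume "\<exists>x y z. tri (parcs G) x y z \<and>
     K = \<lparr>pverts = {x, y, z}, parcs = {(x, y), (y, z), (z, x)}\<rparr>"
    then obtain x y z where t: "tri (parcs G) x y z"
      and K: "K = \<lparr>pverts = {x, y, z}, parcs = {(x, y), (y, z), (z, x)}\<rparr>" by blast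
    define f where "f i = [x, y, z] ! i" for i
    have "inj_on f {..<3}" unfolding three using t no_opposite_arcs
      by (auto simp: f_def)
    moreover have "f ` {..<3} \<subseteq> pverts G" unfolding three using t wellformed'
      by (auto simp: f_def)
    moreover have "\<forall>i<3. (f i, f (Suc i mod 3)) \<in> parcs G"
    proof (intro allI impI)
      fix i :: nat assume "i < 3"
      then consider "i = 0" | "i = 1" | "i = 2" by linarith
      then show "(f i, f (Suc i mod 3)) \<in> parcs G"
        using t by cases (simp_all add: f_def numeral_2_eq_2)
    qed
    moreover have "K = \<lparr>pverts = f ` {..<3}, parcs = (\<lambda>i. (f i, f (Suc i mod 3))) ` {..<3}\<rparr>"
      unfolding three K by (simp add: f_def numeral_2_eq_2)
    ultimately show "K \<in> copies (dicycle 3) G"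
      using copies_dicycle_iff[OF wf] by blast
  qed
  \<comment> \<open>A directed triangle in an oriented graph is induced, so its vertex set
    determines the copy.\<close>
  have "parcs K = parcs G \<inter> pverts K \<times> pverts K" if K_in: "K \<in> copies (dicycle 3) G" for K
  proof -
    obtain x y z where t: "tri (parcs G) x y z"
      and K: "K = \<lparr>pverts = {x, y, z}, parcs = {(x, y), (y, z), (z, x)}\<rparr>"
      using K_in copies by blast
    have "(y, x) \<notin> parcs G" "(z, y) \<notin> parcs G" "(x, z) \<notin> parcs G"
      "(x, x) \<notin> parcs G" "(y, y) \<notin> parcs G" "(z, z) \<notin> parcs G"
      using t no_opposite_arcs by blast+
    with t show ?thesis by (auto simp: K)
  qed
  then have "inj_on pverts (copies (dicycle 3) G)"
    by (intro inj_onI pair_pre_digraph.equality) auto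
  moreover have "pverts ` copies (dicycle 3) G = triangles (parcs G)"
    unfolding triangles_def set_eq_iff image_iff Bex_def copies by fastforce
  ultimately show ?thesis by (metis card_image)
qed

section \<open>The balanced blow-up of the directed triangle\<close>

text \<open>The parts are the residue classes modulo 3, which are balanced for every
  \<open>n\<close>.\<close>

definition blowup :: "nat \<Rightarrow> nat pair_pre_digraph" where
  "blowup n = \<lparr>pverts = {..<n}, parcs = {(i, j). i < n \<and> j < n \<and> j mod 3 = Suc i mod 3}\<rparr>"

lemma card_pverts_blowup: "card (pverts (blowup n)) = n"
  by (simp add: blowup_def)

lemma oriented_graph_blowup: "oriented_graph (blowup n)"
proof
  show "finite (parcs (blowup n))"
    by (rule finite_subset[of _ "{..<n} \<times> {..<n}"]) (auto simp: blowup_def)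
  have residues: "i mod 3 \<noteq> Suc j mod 3" if "j mod 3 = Suc i mod 3" for i j :: nat
    using that by presburger
  show "(v, u) \<notin> parcs (blowup n)" if "(u, v) \<in> parcs (blowup n)" for u v
    using that residues by (simp add: blowup_def)
  then show "fst e \<noteq> snd e" if "e \<in> parcs (blowup n)" for e
    using that by (metis prod.collapse)
qed (auto simp: blowup_def)

text \<open>Every arc raises the residue by one, so going once around a cycle of length
  \<open>l\<close> forces \<open>3 dvd l\<close>.\<close>

lemma copies_dicycle_blowup:
  assumes "l > 0" "\<not> 3 dvd l"
  shows "copies (dicycle l) (blowup n) = {}"
proof (rule ccontr)
  interpret oriented_graph "blowup n" by (rule oriented_graph_blowup)
  have wf: "pair_wf_digraph (blowup n)" by unfold_locales
  assume "copies (dicycle l) (blowup n) \<noteq> {}"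
  then obtain f where f: "\<And>i. i < l \<Longrightarrow> (f i, f (Suc i mod l)) \<in> parcs (blowup n)"
    using copies_dicycle_iff[OF wf] by blast
  have step: "f (Suc i mod l) mod 3 = Suc (f i) mod 3" if "i < l" for i
    using f[OF that] by (simp add: blowup_def)
  have mod: "f i mod 3 = (f 0 + i) mod 3" if "i < l" for i
    using that
  proof (induction i)
    case (Suc i)
    then show ?case using step[of i] by (simp add: mod_Suc_eq) (metis mod_Suc_eq)
  qed simp
  have "f 0 mod 3 = Suc (f (l - 1)) mod 3"
    using step[of "l - 1"] assms(1) by simp
  also have "\<dots> = (f 0 + l) mod 3"
    using mod[of "l - 1"] assms(1) by (metis Suc_pred' add_Suc_right diff_less mod_Suc_eq zero_less_one)
  finally have "3 dvd l"
    by presburger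
  with assms show False by simp
qed

lemma card_residue_class: "r < 3 \<Longrightarrow> card {i. i < n \<and> i mod 3 = r} = (n + 2 - r) div 3"
proof (induction n)
  case (Suc n)
  have "{i. i < Suc n \<and> i mod 3 = r} =
      (if n mod 3 = r then insert n {i. i < n \<and> i mod 3 = r} else {i. i < n \<and> i mod 3 = r})"
    by (auto simp: less_Suc_eq)
  then have "card {i. i < Suc n \<and> i mod 3 = r} =
      (if n mod 3 = r then Suc ((n + 2 - r) div 3) else (n + 2 - r) div 3)"
    using Suc by simp
  also have "\<dots> = (Suc n + 2 - r) div 3"
  proof -
    from Suc.prems consider "r = 0" | "r = 1" | "r = 2" by linarith
    then show ?thesis by cases (simp_all, presburger+)
  qed
  finally show ?case .
qed auto

text \<open>One vertex from each class gives a triangle, and residues recover the triple from its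
  vertex set.\<close>

lemma card_triangles_blowup: "card (triangles (parcs (blowup n))) \<ge> tripartite n"
proof -
  define C where "C r = {i. i < n \<and> i mod 3 = r}" for r :: nat
  let ?f = "\<lambda>(x, y, z). {x, y, z}"
  have "inj_on ?f (C 0 \<times> C 1 \<times> C 2)"
  proof (rule inj_onI, clarsimp)
    fix x y z x' y' z'
    assume C: "x \<in> C 0" "y \<in> C (Suc 0)" "z \<in> C 2" "x' \<in> C 0" "y' \<in> C (Suc 0)" "z' \<in> C 2"
      and eq: "{x, y, z} = {x', y', z'}"
    have "x \<in> {x', y', z'}" "y \<in> {x', y', z'}" "z \<in> {x', y', z'}"
      using eq by auto
    with C show "x = x' \<and> y = y' \<and> z = z'"
      by (auto simp: C_def)
  qed
  moreover have "?f ` (C 0 \<times> C 1 \<times> C 2) \<subseteq> triangles (parcs (blowup n))"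
  proof clarsimp
    fix x y z assume "x \<in> C 0" "y \<in> C (Suc 0)" "z \<in> C 2"
    then have "tri (parcs (blowup n)) x y z"
      by (auto simp: C_def blowup_def mod_Suc)
    then show "{x, y, z} \<in> triangles (parcs (blowup n))"
      unfolding triangles_def by blast
  qed
  moreover have "finite (triangles (parcs (blowup n)))"
    by (rule finite_triangles[of "{..<n}"]) (auto simp: blowup_def)
  ultimately have "card (C 0 \<times> C 1 \<times> C 2) \<le> card (triangles (parcs (blowup n)))"
    by (rule card_inj_on_le)
  moreover have "card (C 0 \<times> C 1 \<times> C 2) = tripartite n"
    by (simp add: card_cartesian_product C_def card_residue_class tripartite_def mult_ac)
  ultimately show ?thesis by simp
qed

section \<open>The extremal numbers\<close>

lemma gen_turan_ge:
  assumes "l > 0" "\<not> 3 dvd l"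
  shows "tripartite n \<le> gen_turan n (dicycle 3) (dicycle l)"
proof -
  have "tripartite n \<le> card (copies (dicycle 3) (blowup n))"
    using card_copies_dicycle_3[OF oriented_graph_blowup] card_triangles_blowup by simp
  also have "\<dots> \<le> gen_turan n (dicycle 3) (dicycle l)"
    unfolding gen_turan_def
    using oriented_graph_blowup copies_dicycle_blowup[OF assms] card_pverts_blowup
    by (intro Max_ge finite_copy_numbers CollectI exI[of _ "blowup n"]) simp
  finally show ?thesis .
qed

lemma gen_turan_le:
  assumes "l > 0" "\<not> 3 dvd l"
    and bound: "\<And>(V :: nat set) E. finite V \<Longrightarrow> card V = n \<Longrightarrow> E \<subseteq> V \<times> V \<Longrightarrow> asym E \<Longrightarrow>
       (\<And>xs. length xs = l \<Longrightarrow> \<not> is_dicycle E xs) \<Longrightarrow> card (triangles E) \<le> m"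
  shows "gen_turan n (dicycle 3) (dicycle l) \<le> m"
proof -
  have "card (copies (dicycle 3) G) \<le> m"
    if G: "oriented_graph G" "card (pverts G) = n" "copies (dicycle l) G = {}"
    for G :: "nat pair_pre_digraph"
  proof -
    interpret oriented_graph G by fact
    have wf: "pair_wf_digraph G" by unfold_locales
    show ?thesis
      unfolding card_copies_dicycle_3[OF G(1)]
    proof (rule bound)
      show "parcs G \<subseteq> pverts G \<times> pverts G" using wellformed' by auto
      show "asym (parcs G)" using no_opposite_arcs by (auto intro: asymI)
      show "\<not> is_dicycle (parcs G) xs" if "length xs = l" for xs
        using copies_dicycle_empty_imp_free[OF wf] G(3) that by blast
    qed (use G(2) pair_finite_verts in auto)
  qed
  \<comment> \<open>\<open>Max\<close> is bounded through its elements only on a nonempty set; the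
    blow-up supplies a member.\<close>
  moreover have "card (copies (dicycle 3) (blowup n)) \<in>
      {card (copies (dicycle 3) G) | G :: nat pair_pre_digraph.
            oriented_graph G \<and> card (pverts G) = n \<and> copies (dicycle l) G = {}}"
    using oriented_graph_blowup copies_dicycle_blowup[OF assms(1,2)] card_pverts_blowup
    by (intro CollectI exI[of _ "blowup n"]) simp
  ultimately show ?thesis
    unfolding gen_turan_def
    by (subst Max_le_iff) (use finite_copy_numbers in auto)
qed

lemma gen_turan_4_5:
  assumes "l \<in> {4, 5}"
  shows "gen_turan n (dicycle 3) (dicycle l) = tripartite n"
proof (rule antisym)
  have l: "l > 0" "\<not> 3 dvd l" using assms by auto
  show "gen_turan n (dicycle 3) (dicycle l) \<le> tripartite n"
    using card_triangles_le_tripartite assms by (intro gen_turan_le l) blast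
  show "tripartite n \<le> gen_turan n (dicycle 3) (dicycle l)"
    using l by (rule gen_turan_ge)
qed

section \<open>Ceiling form and cubic asymptotics\<close>

lemma tripartite_eq_ceilings:
  "int (tripartite n) = \<lceil>real n / 3\<rceil> * \<lceil>(real n - 1) / 3\<rceil> * \<lceil>(real n - 2) / 3\<rceil>"
proof -
  \<comment> \<open>Stated over \<open>int\<close> because \<open>n - 1\<close> and
    \<open>n - 2\<close> may be negative.\<close>
  have ceil: "\<lceil>real_of_int m / 3\<rceil> = (m + 2) div 3" for m :: int
  proof -
    have "3 * ((m + 2) div 3) < m + 3" "m \<le> 3 * ((m + 2) div 3)" by linarith+
    then have "real_of_int (3 * ((m + 2) div 3)) < real_of_int (m + 3)"
      "real_of_int m \<le> real_of_int (3 * ((m + 2) div 3))"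
      by (simp_all only: of_int_less_iff of_int_le_iff)
    then show ?thesis by (intro ceiling_unique) simp_all
  qed
  have "\<lceil>real n / 3\<rceil> = (int n + 2) div 3" "\<lceil>(real n - 1) / 3\<rceil> = (int n + 1) div 3"
    "\<lceil>(real n - 2) / 3\<rceil> = int n div 3"
    using ceil[of "int n"] ceil[of "int n - 1"] ceil[of "int n - 2"] by simp_all
  then show ?thesis
    by (simp add: tripartite_def zdiv_int ac_simps)
qed

text \<open>The arithmetic-geometric mean inequality for three parts with sum
  \<open>n\<close>.\<close>

lemma tripartite_le: "real (tripartite n) \<le> real n ^ 3 / 27"
proof (cases n rule: tripartite_cases)
  case (1 k)
  then show ?thesis by (simp add: power_mult_distrib)
next
  case (2 k)
  then show ?thesis by (simp add: power3_eq_cube power2_eq_square field_simps)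
next
  case (3 k)
  then show ?thesis by (simp add: power3_eq_cube power2_eq_square field_simps)
qed

lemma tripartite_ge: "real n ^ 3 / 27 - real n ^ 2 \<le> real (tripartite n)"
proof (cases n rule: tripartite_cases)
  case (1 k)
  then show ?thesis by (simp add: power_mult_distrib)
next
  case (2 k)
  then show ?thesis by (simp add: power3_eq_cube power2_eq_square field_simps)
next
  case (3 k)
  then show ?thesis by (simp add: power3_eq_cube power2_eq_square field_simps)
qed

theorem theorem3p10:
  shows "(\<forall>l \<in> {4, 5}. \<forall>n :: nat. n > 0 \<longrightarrow>
            int (gen_turan n (dicycle 3) (dicycle l)) =
              \<lceil>real n / 3\<rceil> * \<lceil>(real n - 1) / 3\<rceil> * \<lceil>(real n - 2) / 3\<rceil>) \<and>
         (\<forall>l :: nat. l > 6 \<and> \<not> 3 dvd l \<longrightarrow>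
            (\<lambda>n :: nat. real (gen_turan n (dicycle 3) (dicycle l)) - real n ^ 3 / 27)
              \<in> O(\<lambda>n. real n ^ 2))"
proof (intro conjI ballI allI impI)
  fix l n :: nat
  assume "l \<in> {4, 5}" "n > 0"
  then show "int (gen_turan n (dicycle 3) (dicycle l)) =
      \<lceil>real n / 3\<rceil> * \<lceil>(real n - 1) / 3\<rceil> * \<lceil>(real n - 2) / 3\<rceil>"
    by (simp only: gen_turan_4_5 tripartite_eq_ceilings)
next
  fix l :: nat
  assume l: "l > 6 \<and> \<not> 3 dvd l"
  have "\<bar>real (gen_turan n (dicycle 3) (dicycle l)) - real n ^ 3 / 27\<bar> \<le> real l * real n ^ 2" for n
  proof -
    have "gen_turan n (dicycle 3) (dicycle l) \<le> tripartite n + l * n ^ 2"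
      using l card_triangles_le_tripartite_plus by (intro gen_turan_le) auto
    then have "real (gen_turan n (dicycle 3) (dicycle l)) \<le> real (tripartite n + l * n ^ 2)"
      by (simp only: of_nat_le_iff)
    moreover have "real (tripartite n) \<le> real (gen_turan n (dicycle 3) (dicycle l))"
      using l gen_turan_ge[of l n] by simp
    \<comment> \<open>The error is at most \<open>l * n ^ 2\<close> above, from pruning, and
      \<open>n ^ 2\<close> below, from rounding; the constant \<open>l\<close> covers both.\<close>
    moreover have "real n ^ 2 \<le> real l * real n ^ 2"
      using l by (simp add: mult_le_cancel_right1)
    ultimately show ?thesis
      using tripartite_le[of n] tripartite_ge[of n] by simp
  qed
  then show "(\<lambda>n :: nat. real (gen_turan n (dicycle 3) (dicycle l)) - real n ^ 3 / 27)
      \<in> O(\<lambda>n. real n ^ 2)"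
    by (intro bigoI[of _ "real l"]) simp
qed

end
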